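(* Let $\phi:[0,\infty)\to[0,\infty)$ be an unbounded, increasing, continuous function with $\phi(0)=0$. The following conditions on $\phi$ are equivalent: (i) $0<\alpha_\phi\le\beta_\phi<\infty$. (ii) There exist increasing homeomorphisms $\psi_1,\psi_2:[0,\infty)\to[0,\infty)$ such that $\psi_1(t)\phi(x)\le\phi(tx)\le\psi_2(t)\phi(x)$ for all $t,x>0$. (iii) There exist an increasing homeomorphism $\psi_1:[0,\infty)\to[0,\infty)$ and a function $\psi_2:[0,\infty)\to[0,\infty)$ such that $\psi_1(t)\phi(x)\le\phi(tx)\le\psi_2(t)\phi(x)$ for all $t,x>0$.
   Context: "Increasing" means strictly increasing. For $t>0$ put $$M(t,\phi):=\sup_{x>0}\frac{\phi(tx)}{\phi(x)}\in(0,\infty].$$ This function is nondecreasing and submultiplicative with $M(1,\phi)=1$. The Orlicz space indices (Matuszewska–Orlicz indices) of $\phi$ are $$\alpha_\phi:=\lim_{t\to0^+}\frac{\ln M(t,\phi)}{\ln t},\qquad \beta_\phi:=\lim_{t\to\infty}\frac{\ln M(t,\phi)}{\ln t};$$ these limits are known to exist in $[0,\infty]$ and satisfy $0\le\alpha_\phi\le\beta_\phi\le\infty$ (with $\ln\infty=\infty$). *)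

theory Defs
  imports "HOL-Analysis.Analysis"
begin

text \<open>
  Functions on \<open>[0,\<infinity>)\<close> are represented by functions on \<^typ>\<open>real\<close> of which only the values on
  \<open>{0..}\<close> matter.
\<close>

definition M_fun :: "real \<Rightarrow> (real \<Rightarrow> real) \<Rightarrow> ereal" where
  "M_fun t \<phi> = (SUP x\<in>{0<..}. ereal (\<phi> (t * x) / \<phi> x))"

text \<open>
  The logarithm on \<open>(0,\<infinity>]\<close>, with \<open>ln \<infinity> = \<infinity>\<close>.  Values at arguments \<open>\<le> 0\<close> are set to \<open>-\<infinity>\<close>;
  they play no role, since \<open>M_fun t \<phi> > 0\<close> for the functions considered.
\<close>

definition ereal_ln :: "ereal \<Rightarrow> ereal" where
  "ereal_ln y =
     (if y = \<infinity> then \<infinity> else if y \<le> 0 then -\<infinity> else ereal (ln (real_of_ereal y)))"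

text \<open>The Matuszewska--Orlicz indices; the limits are taken in the extended reals.\<close>

definition lower_index :: "(real \<Rightarrow> real) \<Rightarrow> ereal" where
  "lower_index \<phi> = Lim (at_right 0) (\<lambda>t. ereal_ln (M_fun t \<phi>) / ereal (ln t))"

definition upper_index :: "(real \<Rightarrow> real) \<Rightarrow> ereal" where
  "upper_index \<phi> = Lim at_top (\<lambda>t. ereal_ln (M_fun t \<phi>) / ereal (ln t))"

definition increasing_homeo :: "(real \<Rightarrow> real) \<Rightarrow> bool" where
  "increasing_homeo \<psi> \<longleftrightarrow>
     strict_mono_on {0..} \<psi> \<and> (\<exists>\<psi>'. homeomorphism {0..} {0..} \<psi> \<psi>')"

end

theory Submission
  imports Defs
begin

text \<open>
  The bound \<open>\<phi> (t * x) \<le> \<psi> t * \<phi> x\<close> for all \<open>x > 0\<close> says exactly that \<open>M_fun t \<phi> \<le> \<psi> t\<close>.  So an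
  increasing homeomorphism dominating \<open>\<phi> (t * x) / \<phi> x\<close> exists when the dilation function is finite
  everywhere and tends to \<open>0\<close> at \<open>0\<close> in a controlled way, and the two indices measure this.

  Replacing \<open>(t, x)\<close> by \<open>(1 / t, t * x)\<close> turns an upper bound with \<open>\<psi>\<close> into a lower bound with
  \<open>t \<mapsto> 1 / \<psi> (1 / t)\<close> and conversely (\<open>dilation_inverse\<close>), and this conjugation maps increasing
  homeomorphisms to increasing homeomorphisms (\<open>increasing_homeo_inverse_conj\<close>).  Hence one of the
  two homeomorphisms can always be recovered from the other.  This makes (ii) and (iii) equivalent,
  and it reduces (ii) to the existence of a dominating homeomorphism \<open>\<psi>\<close>.

  If the indices are positive and finite, choose exponents \<open>0 < a\<close> below the lower index and \<open>b\<close>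
  above the upper one.  By the definition of the indices \<open>M_fun t \<phi>\<close> is at most \<open>t powr a\<close> near \<open>0\<close>
  and at most \<open>t powr b\<close> near \<open>\<infinity>\<close>, and monotonicity of \<open>\<phi>\<close> covers the compact range in between, so
  \<open>\<psi> t = C * (t powr a + t powr b)\<close> works (\<open>dilation_le_of_indices\<close>).

  For the converse, \<open>log_M u\<close>, the logarithm of \<open>M_fun (exp u) \<phi>\<close>, is subadditive, so by Fekete's
  lemma (\<open>subadditive_tendsto_INF\<close>) the limits defining the indices exist and are an infimum of
  \<open>log_M u / u\<close> and minus an infimum of \<open>log_M (- u) / u\<close> over \<open>u > 0\<close>.  A single value then decides
  each bound: \<open>M_fun t \<phi> < 1\<close> for one \<open>t < 1\<close> makes the lower index positive, and finiteness of
  \<open>M_fun\<close> makes the upper index finite.  The order of the indices comes from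
  \<open>0 = log_M 0 \<le> log_M u + log_M (- u)\<close>.  The existence of the limits is also what turns the
  hypothesis of the first implication into information about \<open>M_fun\<close>, because the value of \<open>Lim\<close>
  says nothing when the limit does not exist.
\<close>

section \<open>Increasing homeomorphisms of the half-line\<close>

text \<open>
  A monotone map with open range is continuous.  Since \<open>{0..}\<close> is not open, the map is first
  extended by the identity on the negative half-line to a monotone surjection of the whole line.
\<close>
lemma strict_mono_onto_imp_continuous:
  fixes \<psi> :: "real \<Rightarrow> real"
  assumes mono: "strict_mono_on {0..} \<psi>" and onto: "\<psi> ` {0..} = {0..}"
  shows "continuous_on {0..} \<psi>"
proof -
  define f where "f x = (if x < 0 then x else \<psi> x)" for x
  have nn: "\<psi> x \<ge> 0" if "x \<ge> 0" for x using onto that by auto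
  have "surj f"
    unfolding surj_def
  proof (rule allI)
    fix y :: real
    show "\<exists>x. y = f x"
    proof (cases "y < 0")
      case False
      then obtain x where "x \<ge> 0" "y = \<psi> x" using onto by (metis atLeast_iff imageE not_less)
      then show ?thesis by (auto simp: f_def intro!: exI[of _ x])
    qed (auto simp: f_def intro!: exI[of _ y])
  qed
  moreover have "f x \<le> f y" if "x \<le> y" for x y
    using that nn[of y] strict_mono_on_leD[OF mono, of x y] by (auto simp: f_def)
  ultimately have "continuous_on UNIV f" by (intro continuous_onI_mono) auto
  then have "continuous_on {0..} f" by (rule continuous_on_subset) auto
  then show ?thesis by (rule continuous_on_eq) (auto simp: f_def)
qed

text \<open>
  The inverse of a strictly increasing bijection of \<open>{0..}\<close> is again one, so both are continuous for
  the same reason; no topology needs to be checked to recognise an increasing homeomorphism.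
\<close>
lemma increasing_homeo_iff:
  "increasing_homeo \<psi> \<longleftrightarrow> strict_mono_on {0..} \<psi> \<and> \<psi> ` {0..} = {0..}"
proof
  assume "increasing_homeo \<psi>"
  then show "strict_mono_on {0..} \<psi> \<and> \<psi> ` {0..} = {0..}"
    by (auto simp: increasing_homeo_def dest: homeomorphism_image1)
next
  assume *: "strict_mono_on {0..} \<psi> \<and> \<psi> ` {0..} = {0..}"
  define \<psi>' where "\<psi>' = the_inv_into {0..} \<psi>"
  have inj: "inj_on \<psi> {0..}" using * by (auto intro: strict_mono_on_imp_inj_on)
  have l: "\<psi>' (\<psi> x) = x" if "x \<ge> 0" for x
    using that inj by (auto simp: \<psi>'_def intro: the_inv_into_f_f)
  have r: "\<psi> (\<psi>' y) = y" if "y \<ge> 0" for y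
    using that * unfolding \<psi>'_def by (intro f_the_inv_into_f[OF inj]) auto
  have im: "\<psi>' ` {0..} = {0..}"
    unfolding \<psi>'_def using the_inv_into_onto[OF inj] * by simp
  have "strict_mono_on {0..} \<psi>'"
  proof (rule strict_mono_onI)
    fix x y :: real assume xy: "x \<in> {0..}" "y \<in> {0..}" "x < y"
    show "\<psi>' x < \<psi>' y"
    proof (rule ccontr)
      assume "\<not> \<psi>' x < \<psi>' y"
      then have "\<psi> (\<psi>' y) \<le> \<psi> (\<psi>' x)"
        using * im xy by (intro strict_mono_on_leD[of "{0..}" \<psi>]) auto
      then show False using xy r by auto
    qed
  qed
  then have "homeomorphism {0..} {0..} \<psi> \<psi>'"
    using * im l r by (intro homeomorphismI strict_mono_onto_imp_continuous) auto
  then show "increasing_homeo \<psi>" using * by (auto simp: increasing_homeo_def)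
qed

lemma increasing_homeo_zero: "increasing_homeo \<psi> \<Longrightarrow> \<psi> 0 = 0"
proof -
  assume "increasing_homeo \<psi>"
  then have *: "strict_mono_on {0..} \<psi>" "\<psi> ` {0..} = {0..}" by (auto simp: increasing_homeo_iff)
  then obtain x where x: "x \<ge> 0" "\<psi> x = 0" by (metis atLeast_iff imageE order_refl)
  have "\<psi> 0 \<le> \<psi> x" using x * by (intro strict_mono_on_leD[of "{0..}" \<psi>]) auto
  moreover have "\<psi> 0 \<ge> 0" using *(2) by auto
  ultimately show ?thesis using x by simp
qed

lemma increasing_homeo_pos:
  assumes "increasing_homeo \<psi>" "t > 0"
  shows "\<psi> t > 0"
  using assms strict_mono_onD[of "{0..}" \<psi> 0 t] increasing_homeo_zero[of \<psi>]
  by (auto simp: increasing_homeo_def)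

text \<open>
  With the convention \<open>inverse 0 = 0\<close>, inversion is a bijection of \<open>{0..}\<close> that reverses the order of
  the positive numbers, so conjugating by it reverses the order twice and fixes \<open>0\<close> automatically.
\<close>
lemma increasing_homeo_inverse_conj:
  assumes "increasing_homeo \<psi>"
  shows "increasing_homeo (\<lambda>t. inverse (\<psi> (inverse t)))"
proof -
  have *: "strict_mono_on {0..} \<psi>" "\<psi> ` {0..} = {0..}"
    using assms by (auto simp: increasing_homeo_iff)
  have inv: "inverse ` {0..} = {0::real..}"
  proof (intro equalityI subsetI)
    fix x :: real assume "x \<in> {0..}"
    then show "x \<in> inverse ` {0..}" by (intro image_eqI[of _ _ "inverse x"]) auto
  qed auto
  have "(\<lambda>t. inverse (\<psi> (inverse t))) ` {0..} = inverse ` (\<psi> ` (inverse ` {0..}))"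
    by (simp add: image_image)
  also have "\<dots> = {0..}" by (simp only: inv *)
  finally have im: "(\<lambda>t. inverse (\<psi> (inverse t))) ` {0..} = {0..}" .
  have "strict_mono_on {0..} (\<lambda>t. inverse (\<psi> (inverse t)))"
  proof (rule strict_mono_onI)
    fix s t :: real assume st: "s \<in> {0..}" "t \<in> {0..}" "s < t"
    show "inverse (\<psi> (inverse s)) < inverse (\<psi> (inverse t))"
    proof (cases "s = 0")
      case True
      then show ?thesis
        using st increasing_homeo_pos[OF assms, of "inverse t"] increasing_homeo_zero[OF assms] by simp
    next
      case False
      then have "\<psi> (inverse t) < \<psi> (inverse s)"
        using st by (intro strict_mono_onD[OF *(1)]) auto
      then show ?thesis
        using st increasing_homeo_pos[OF assms, of "inverse t"] by (intro less_imp_inverse_less) auto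
    qed
  qed
  then show ?thesis using im by (simp add: increasing_homeo_iff)
qed

lemma increasing_homeo_sum_powr:
  fixes a b C :: real
  assumes "a > 0" "b > 0" "C > 0"
  shows "increasing_homeo (\<lambda>t. C * (t powr a + t powr b))"
proof -
  let ?f = "\<lambda>t. C * (t powr a + t powr b)"
  have mono: "strict_mono_on {0..} ?f"
    using assms by (auto intro!: strict_mono_onI add_strict_mono powr_less_mono2)
  have cont: "continuous_on {0..} ?f"
    using assms by (intro continuous_intros continuous_on_powr') auto
  have "y \<in> ?f ` {0..}" if "y \<ge> 0" for y
  proof -
    \<comment> \<open>The first summand alone already reaches \<open>y\<close> at \<open>T\<close>.\<close>
    define T where "T = (y / C) powr (1 / a)"
    have "y = C * T powr a" using that assms by (simp add: T_def powr_powr)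
    then have "y \<le> ?f T" using assms by simp
    then have "\<exists>x. 0 \<le> x \<and> x \<le> T \<and> ?f x = y"
      using that assms by (intro IVT' continuous_on_subset[OF cont]) (auto simp: T_def)
    then show ?thesis by auto
  qed
  then have "?f ` {0..} = {0..}" using assms by auto
  then show ?thesis using mono by (simp add: increasing_homeo_iff)
qed

section \<open>Fekete's lemma on the half-line\<close>

lemma subadditive_nat_mult:
  fixes g :: "real \<Rightarrow> real"
  assumes sub: "\<And>u v. u \<ge> 0 \<Longrightarrow> v \<ge> 0 \<Longrightarrow> g (u + v) \<le> g u + g v"
    and "u \<ge> 0" "r \<ge> 0"
  shows "g (real n * u + r) \<le> real n * g u + g r"
proof (induction n)
  case (Suc n)
  have "g (real (Suc n) * u + r) = g (u + (real n * u + r))" by (simp add: algebra_simps)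
  also have "\<dots> \<le> g u + g (real n * u + r)" using assms by (intro sub) auto
  also have "\<dots> \<le> g u + (real n * g u + g r)" using Suc by simp
  finally show ?case by (simp add: algebra_simps)
qed simp

text \<open>
  Fekete's lemma.  For fixed \<open>u0\<close>, write \<open>u = n * u0 + r\<close> with \<open>0 \<le> r < u0\<close>.  Subadditivity gives
  \<open>g u \<le> n * g u0 + g r\<close>, and local boundedness turns this into
  \<open>g u / u \<le> g u0 / u0 + O(1 / u)\<close>; so no quotient lies below the limit superior.  The limit is taken
  in the extended reals because the infimum may be \<open>-\<infinity>\<close>.
\<close>
lemma subadditive_tendsto_INF:
  fixes g :: "real \<Rightarrow> real"
  assumes sub: "\<And>u v. u \<ge> 0 \<Longrightarrow> v \<ge> 0 \<Longrightarrow> g (u + v) \<le> g u + g v"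
    and bdd: "\<And>a. bdd_above (g ` {0..a})"
  shows "((\<lambda>u. ereal (g u / u)) \<longlongrightarrow> (INF u\<in>{0<..}. ereal (g u / u))) at_top"
proof (rule order_tendstoI)
  fix c assume "c < (INF u\<in>{0<..}. ereal (g u / u))"
  then have "c < ereal (g u / u)" if "u > 0" for u
    using that by (auto intro: less_le_trans INF_lower)
  then show "\<forall>\<^sub>F u in at_top. c < ereal (g u / u)"
    by (intro eventually_mono[OF eventually_gt_at_top[of 0]])
next
  fix c assume "(INF u\<in>{0<..}. ereal (g u / u)) < c"
  then obtain u0 where u0: "u0 > 0" "ereal (g u0 / u0) < c" by (auto simp: INF_less_iff)
  define q where "q = g u0 / u0"
  obtain K where K: "\<And>r. r \<in> {0..u0} \<Longrightarrow> g r \<le> K" using bdd[of u0] unfolding bdd_above_def by blast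
  have le: "g u / u \<le> q + (K + u0 * \<bar>q\<bar>) / u" if u: "u > 0" for u
  proof -
    define n where "n = nat \<lfloor>u / u0\<rfloor>"
    define r where "r = u - real n * u0"
    have n: "real n = of_int \<lfloor>u / u0\<rfloor>" using u u0 by (simp add: n_def)
    have "real n \<le> u / u0" "u / u0 \<le> real n + 1" unfolding n by linarith+
    then have r: "0 \<le> r" "r \<le> u0" using u0 by (auto simp: r_def field_simps)
    have "g u = g (real n * u0 + r)" by (simp add: r_def)
    also have "\<dots> \<le> real n * g u0 + g r"
      using r u0 by (intro subadditive_nat_mult sub) auto
    also have "real n * g u0 = u * q - r * q" using u0 by (simp add: r_def q_def field_simps)
    also have "- (r * q) \<le> u0 * \<bar>q\<bar>"
    proof -
      have "- (r * q) \<le> r * \<bar>q\<bar>" using r by (metis abs_ge_minus_self abs_mult abs_of_nonneg)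
      also have "\<dots> \<le> u0 * \<bar>q\<bar>" using r by (intro mult_right_mono) auto
      finally show ?thesis .
    qed
    then have "u * q - r * q + g r \<le> u * q + (K + u0 * \<bar>q\<bar>)" using K[of r] r by auto
    finally show ?thesis using u by (simp add: field_simps)
  qed
  have "((\<lambda>u. q + (K + u0 * \<bar>q\<bar>) / u) \<longlongrightarrow> q + 0) at_top"
    by (intro tendsto_intros tendsto_divide_0[OF tendsto_const] filterlim_at_top_imp_at_infinity filterlim_ident)
  then have "((\<lambda>u. ereal (q + (K + u0 * \<bar>q\<bar>) / u)) \<longlongrightarrow> ereal q) at_top"
    by simp
  from order_tendstoD(2)[OF this u0(2)[folded q_def]] eventually_gt_at_top[of 0]
  show "\<forall>\<^sub>F u in at_top. ereal (g u / u) < c"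
  proof eventually_elim
    case (elim u)
    then show ?case using le[of u] by (meson ereal_less_eq(3) le_less_trans)
  qed
qed

section \<open>The dilation function\<close>

lemma ereal_ln_ereal: "m > 0 \<Longrightarrow> ereal_ln (ereal m) = ereal (ln m)"
  by (simp add: ereal_ln_def)

text \<open>
  The two assumptions make \<open>\<phi>\<close> positive on \<open>{0<..}\<close>, so no quotient \<open>\<phi> (t * x) / \<phi> x\<close> with \<open>x > 0\<close>
  is a division by zero.
\<close>
locale increasing_half_line =
  fixes \<phi> :: "real \<Rightarrow> real"
  assumes mono: "strict_mono_on {0..} \<phi>" and zero: "\<phi> 0 = 0"
begin

lemma pos: "x > 0 \<Longrightarrow> \<phi> x > 0"
  using strict_mono_onD[OF mono, of 0 x] zero by simp

lemma le: "0 \<le> x \<Longrightarrow> x \<le> y \<Longrightarrow> \<phi> x \<le> \<phi> y"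
  using strict_mono_on_leD[OF mono, of x y] by simp

lemma M_fun_upper: "x > 0 \<Longrightarrow> ereal (\<phi> (t * x) / \<phi> x) \<le> M_fun t \<phi>"
  unfolding M_fun_def by (rule SUP_upper) simp

lemma M_fun_le_iff: "M_fun t \<phi> \<le> ereal c \<longleftrightarrow> (\<forall>x>0. \<phi> (t * x) \<le> c * \<phi> x)"
  by (auto simp: M_fun_def SUP_le_iff pos pos_divide_le_eq)

lemma M_fun_pos: "t > 0 \<Longrightarrow> M_fun t \<phi> > 0"
  using M_fun_upper[of 1 t] pos[of t] pos[of 1] by (auto intro: less_le_trans[rotated])

lemma M_fun_mono: "0 < s \<Longrightarrow> s \<le> t \<Longrightarrow> M_fun s \<phi> \<le> M_fun t \<phi>"
  unfolding M_fun_def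
  by (intro SUP_mono) (force intro!: divide_right_mono le mult_right_mono less_imp_le[OF pos])

text \<open>
  Dilating by \<open>s * t\<close> is dilating by \<open>t\<close> and then by \<open>s\<close>:
  \<open>\<phi> (s t x) / \<phi> x = (\<phi> (s (t x)) / \<phi> (t x)) * (\<phi> (t x) / \<phi> x)\<close>.
\<close>
lemma M_fun_submult:
  assumes "s > 0" "t > 0"
  shows "M_fun (s * t) \<phi> \<le> M_fun s \<phi> * M_fun t \<phi>"
  unfolding M_fun_def[of "s * t"]
proof (rule SUP_least)
  fix x :: real assume "x \<in> {0<..}"
  then have x: "x > 0" by simp
  have "ereal (\<phi> (s * t * x) / \<phi> x)
      = ereal (\<phi> (s * (t * x)) / \<phi> (t * x)) * ereal (\<phi> (t * x) / \<phi> x)"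
    using pos[of "t * x"] x assms by (simp add: mult.assoc)
  also have "\<dots> \<le> M_fun s \<phi> * M_fun t \<phi>"
    using x assms M_fun_pos[of s]
    by (intro ereal_mult_mono M_fun_upper) (auto intro!: divide_nonneg_pos pos less_imp_le[OF pos])
  finally show "ereal (\<phi> (s * t * x) / \<phi> x) \<le> M_fun s \<phi> * M_fun t \<phi>" .
qed

lemma M_fun_one: "M_fun 1 \<phi> = 1"
  using M_fun_upper[of 1 1] M_fun_le_iff[of 1 1] pos[of 1] by (auto simp: one_ereal_def intro!: antisym)

lemma M_fun_le_one: "0 < t \<Longrightarrow> t \<le> 1 \<Longrightarrow> M_fun t \<phi> \<le> 1"
  using M_fun_mono[of t 1] M_fun_one by simp

text \<open>
  Submultiplicativity makes \<open>M_fun\<close> finite at all powers of \<open>s\<close>, and these exceed every \<open>t\<close>.  Hence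
  \<open>M_fun\<close> is either finite everywhere or infinite on all of \<open>(1,\<infinity>)\<close>, and the upper index has only
  these two cases.
\<close>
lemma M_fun_finite_propagates:
  assumes "s > 1" "M_fun s \<phi> < \<infinity>" "t > 0"
  shows "M_fun t \<phi> < \<infinity>"
proof -
  have "M_fun (s ^ n) \<phi> < \<infinity>" for n
  proof (induction n)
    case (Suc n)
    have "M_fun (s ^ Suc n) \<phi> \<le> M_fun s \<phi> * M_fun (s ^ n) \<phi>"
      using assms by (simp add: M_fun_submult)
    also have "\<dots> < \<infinity>"
      using Suc assms M_fun_pos[of s] M_fun_pos[of "s ^ n"]
      by (cases "M_fun s \<phi>"; cases "M_fun (s ^ n) \<phi>") auto
    finally show ?case .
  qed (simp add: M_fun_one)
  moreover obtain n where "t < s ^ n" using real_arch_pow[OF assms(1)] by blast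
  ultimately show ?thesis using M_fun_mono[of t "s ^ n"] assms by (meson le_less_trans less_imp_le)
qed

text \<open>
  The logarithmic variable \<open>u = ln t\<close> makes submultiplicativity of \<open>M_fun\<close> subadditivity.  The values
  are meaningful only where \<open>M_fun (exp u) \<phi>\<close> is finite, which includes all \<open>u \<le> 0\<close>.
\<close>
definition log_M :: "real \<Rightarrow> real" where
  "log_M u = ln (real_of_ereal (M_fun (exp u) \<phi>))"

lemma M_fun_exp:
  assumes "M_fun (exp u) \<phi> < \<infinity>"
  shows "M_fun (exp u) \<phi> = ereal (exp (log_M u))"
  using assms M_fun_pos[of "exp u"] by (cases "M_fun (exp u) \<phi>") (auto simp: log_M_def)

lemma index_quotient:
  assumes "t > 0" "t \<noteq> 1" "M_fun t \<phi> < \<infinity>"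
  shows "ereal_ln (M_fun t \<phi>) / ereal (ln t) = ereal (log_M (ln t) / ln t)"
  using M_fun_exp[of "ln t"] assms by (simp add: ereal_ln_ereal)

lemma log_M_subadditive:
  assumes "M_fun (exp u) \<phi> < \<infinity>" "M_fun (exp v) \<phi> < \<infinity>" "M_fun (exp (u + v)) \<phi> < \<infinity>"
  shows "log_M (u + v) \<le> log_M u + log_M v"
proof -
  have "ereal (exp (log_M (u + v))) \<le> ereal (exp (log_M u)) * ereal (exp (log_M v))"
    using M_fun_submult[of "exp u" "exp v"] assms by (simp flip: M_fun_exp exp_add)
  then show ?thesis by (simp flip: exp_add)
qed

lemma log_M_mono:
  assumes "u \<le> v" "M_fun (exp v) \<phi> < \<infinity>"
  shows "log_M u \<le> log_M v"
proof -
  have "M_fun (exp u) \<phi> \<le> M_fun (exp v) \<phi>" using assms by (intro M_fun_mono) auto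
  then have "ereal (exp (log_M u)) \<le> ereal (exp (log_M v))"
    using assms by (subst (1 2) M_fun_exp[symmetric]) (auto intro: le_less_trans)
  then show ?thesis by simp
qed

lemma M_fun_exp_nonpos_finite: "u \<le> 0 \<Longrightarrow> M_fun (exp u) \<phi> < \<infinity>"
  using M_fun_le_one[of "exp u"] by (auto intro: le_less_trans)

lemma log_M_zero: "log_M 0 = 0"
  by (simp add: log_M_def M_fun_one)

section \<open>The indices as infima of logarithmic quotients\<close>

lemma log_M_neg_tendsto:
  "((\<lambda>u. ereal (log_M (- u) / u)) \<longlongrightarrow> (INF u\<in>{0<..}. ereal (log_M (- u) / u))) at_top"
proof (rule subadditive_tendsto_INF)
  fix u v :: real assume "u \<ge> 0" "v \<ge> 0"
  then show "log_M (- (u + v)) \<le> log_M (- u) + log_M (- v)"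
    using log_M_subadditive[of "- u" "- v"] M_fun_exp_nonpos_finite[of "- u"]
      M_fun_exp_nonpos_finite[of "- v"] M_fun_exp_nonpos_finite[of "- u - v"] by simp
next
  fix a :: real
  show "bdd_above ((\<lambda>u. log_M (- u)) ` {0..a})"
    using M_fun_exp_nonpos_finite[of 0] by (auto intro!: bdd_aboveI2[of _ _ "log_M 0"] log_M_mono)
qed

lemma log_M_tendsto:
  assumes "\<And>t. t > 0 \<Longrightarrow> M_fun t \<phi> < \<infinity>"
  shows "((\<lambda>u. ereal (log_M u / u)) \<longlongrightarrow> (INF u\<in>{0<..}. ereal (log_M u / u))) at_top"
proof (rule subadditive_tendsto_INF)
  fix a :: real
  show "bdd_above (log_M ` {0..a})"
    using assms by (auto intro!: bdd_aboveI2[of _ _ "log_M a"] log_M_mono)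
qed (use assms in \<open>simp add: log_M_subadditive\<close>)

text \<open>
  With \<open>u = - ln t\<close>, which tends to \<open>\<infinity>\<close> as \<open>t\<close> tends to \<open>0\<close>, the quotient is \<open>log_M (- u) / (- u)\<close>,
  the negative of a quotient to which Fekete's lemma applies.
\<close>
lemma lower_index_tendsto:
  "((\<lambda>t. ereal_ln (M_fun t \<phi>) / ereal (ln t)) \<longlongrightarrow> - (INF u\<in>{0<..}. ereal (log_M (- u) / u))) (at_right 0)"
proof -
  have "filterlim (\<lambda>t::real. - ln t) at_top (at_right 0)"
    using ln_at_0 by (simp add: filterlim_uminus_at_bot)
  with log_M_neg_tendsto
  have "((\<lambda>t. ereal (log_M (- (- ln t)) / (- ln t))) \<longlongrightarrow> (INF u\<in>{0<..}. ereal (log_M (- u) / u))) (at_right 0)"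
    by (rule filterlim_compose)
  then have "((\<lambda>t. - ereal (log_M (- (- ln t)) / (- ln t))) \<longlongrightarrow> - (INF u\<in>{0<..}. ereal (log_M (- u) / u))) (at_right 0)"
    by (rule tendsto_uminus_ereal)
  moreover have "\<forall>\<^sub>F t in at_right 0. - ereal (log_M (- (- ln t)) / (- ln t)) = ereal_ln (M_fun t \<phi>) / ereal (ln t)"
    unfolding eventually_at_right_field
  proof (intro exI[of _ 1] conjI allI impI)
    fix t :: real assume t: "0 < t" "t < 1"
    then have "M_fun t \<phi> < \<infinity>" using M_fun_le_one[of t] by (auto intro: le_less_trans)
    then show "- ereal (log_M (- (- ln t)) / (- ln t)) = ereal_ln (M_fun t \<phi>) / ereal (ln t)"
      using t by (subst index_quotient) auto
  qed simp
  ultimately show ?thesis by (rule Lim_transform_eventually)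
qed

lemma lower_index_eq: "lower_index \<phi> = - (INF u\<in>{0<..}. ereal (log_M (- u) / u))"
  unfolding lower_index_def by (intro tendsto_Lim lower_index_tendsto) simp

lemma upper_index_tendsto_finite:
  assumes "\<And>t. t > 0 \<Longrightarrow> M_fun t \<phi> < \<infinity>"
  shows "((\<lambda>t. ereal_ln (M_fun t \<phi>) / ereal (ln t)) \<longlongrightarrow> (INF u\<in>{0<..}. ereal (log_M u / u))) at_top"
proof -
  from filterlim_compose[OF log_M_tendsto[OF assms] ln_at_top]
  have "((\<lambda>t. ereal (log_M (ln t) / ln t)) \<longlongrightarrow> (INF u\<in>{0<..}. ereal (log_M u / u))) at_top" .
  moreover have "\<forall>\<^sub>F t in at_top. ereal (log_M (ln t) / ln t) = ereal_ln (M_fun t \<phi>) / ereal (ln t)"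
    using eventually_gt_at_top[of 1] by eventually_elim (use assms in \<open>simp add: index_quotient\<close>)
  ultimately show ?thesis by (rule Lim_transform_eventually)
qed

lemma upper_index_tendsto_infinite:
  assumes "s > 0" "M_fun s \<phi> = \<infinity>"
  shows "((\<lambda>t. ereal_ln (M_fun t \<phi>) / ereal (ln t)) \<longlongrightarrow> \<infinity>) at_top"
proof (rule tendsto_eventually)
  show "\<forall>\<^sub>F t in at_top. ereal_ln (M_fun t \<phi>) / ereal (ln t) = \<infinity>"
    using eventually_gt_at_top[of 1]
  proof eventually_elim
    case (elim t)
    then have "M_fun t \<phi> = \<infinity>" using M_fun_finite_propagates[of t s] assms by auto
    then show ?case using elim by (simp add: ereal_ln_def)
  qed
qed

text \<open>
  The limit exists in every case, so statements about \<open>upper_index\<close> give information about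
  \<open>M_fun\<close> near \<open>\<infinity>\<close> before finiteness of \<open>M_fun\<close> is known.
\<close>
lemma upper_index_tendsto:
  "((\<lambda>t. ereal_ln (M_fun t \<phi>) / ereal (ln t)) \<longlongrightarrow> upper_index \<phi>) at_top"
proof -
  have "\<exists>l. ((\<lambda>t. ereal_ln (M_fun t \<phi>) / ereal (ln t)) \<longlongrightarrow> l) at_top"
    using upper_index_tendsto_finite upper_index_tendsto_infinite
    by (metis ereal_infty_less(1))
  then show ?thesis unfolding upper_index_def by (auto simp: tendsto_Lim)
qed

section \<open>Indices and two-sided bounds\<close>

text \<open>
  An index bound read near \<open>0\<close> or near \<open>\<infinity>\<close> is a power bound on \<open>M_fun\<close> there.  For \<open>t\<close> in between,
  \<open>\<phi> (t * x) \<le> \<phi> (T * x) \<le> T powr b * \<phi> x\<close>, and \<open>t powr a\<close> is bounded below, so a constant factor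
  suffices.  The sum of the two powers is used because it dominates each of them and is visibly
  increasing and continuous.
\<close>
lemma dilation_le_of_indices:
  assumes "0 < lower_index \<phi>" "upper_index \<phi> < \<infinity>"
  shows "\<exists>a>0. \<exists>b>0. \<exists>C>0. \<forall>t>0. \<forall>x>0. \<phi> (t * x) \<le> C * (t powr a + t powr b) * \<phi> x"
proof -
  obtain a where a: "a > 0" "ereal a < lower_index \<phi>"
    using ereal_dense2[OF assms(1)] by auto
  obtain n :: nat where n: "upper_index \<phi> < ereal (real n)"
    using assms(2) by (auto simp: less_PInf_Ex_of_nat)
  \<comment> \<open>The shift makes \<open>b > 0\<close> immediate; continuity of \<open>t powr b\<close> at \<open>0\<close> requires it.\<close>
  define b where "b = real n + 1"
  have b: "b > 0" "upper_index \<phi> < ereal b"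
    using n by (auto simp: b_def intro: less_trans)
  have "\<forall>\<^sub>F t in at_right 0. ereal a < ereal_ln (M_fun t \<phi>) / ereal (ln t)"
    using order_tendstoD(1)[OF lower_index_tendsto] a(2) by (simp add: lower_index_eq)
  then obtain d where d: "d > 0"
    "\<And>t. 0 < t \<Longrightarrow> t < d \<Longrightarrow> ereal a < ereal_ln (M_fun t \<phi>) / ereal (ln t)"
    by (auto simp: eventually_at_right_field)
  define \<delta> where "\<delta> = min d 1"
  have \<delta>: "\<delta> > 0" "\<delta> \<le> 1" "\<delta> \<le> d" using d(1) by (auto simp: \<delta>_def)
  have small: "\<phi> (t * x) \<le> t powr a * \<phi> x" if t: "0 < t" "t < \<delta>" and x: "x > 0" for t x
  proof -
    have fin: "M_fun t \<phi> < \<infinity>" using M_fun_le_one[of t] t \<delta> by (auto intro: le_less_trans)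
    have "a < log_M (ln t) / ln t" using d(2)[of t] t \<delta> fin by (simp add: index_quotient)
    moreover have "ln t < 0" using t \<delta> by simp
    ultimately have "log_M (ln t) < a * ln t" by (simp add: neg_less_divide_eq)
    then have "M_fun t \<phi> \<le> ereal (t powr a)" using M_fun_exp[of "ln t"] t fin by (simp add: powr_def)
    then show ?thesis using x by (simp add: M_fun_le_iff)
  qed
  have "\<forall>\<^sub>F t in at_top. ereal_ln (M_fun t \<phi>) / ereal (ln t) < ereal b"
    using order_tendstoD(2)[OF upper_index_tendsto b(2)] .
  then obtain T0 where T0: "\<And>t. t \<ge> T0 \<Longrightarrow> ereal_ln (M_fun t \<phi>) / ereal (ln t) < ereal b"
    by (auto simp: eventually_at_top_linorder)
  define T where "T = max T0 2"
  have large: "\<phi> (t * x) \<le> t powr b * \<phi> x" if t: "t \<ge> T" and x: "x > 0" for t x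
  proof -
    have t1: "t > 1" "ereal_ln (M_fun t \<phi>) / ereal (ln t) < ereal b"
      using t T0[of t] by (auto simp: T_def)
    then have fin: "M_fun t \<phi> < \<infinity>" by (cases "M_fun t \<phi> = \<infinity>") (auto simp: ereal_ln_def)
    have "log_M (ln t) / ln t < b" using t1 fin by (simp add: index_quotient)
    then have "log_M (ln t) < b * ln t" using t1 by (simp add: divide_less_eq)
    then have "M_fun t \<phi> \<le> ereal (t powr b)" using M_fun_exp[of "ln t"] t1 fin by (simp add: powr_def)
    then show ?thesis using x by (simp add: M_fun_le_iff)
  qed
  \<comment> \<open>The least factor, at least \<open>1\<close>, for which \<open>C * t powr a\<close> reaches \<open>T powr b\<close> already at \<open>\<delta>\<close>.\<close>
  define C where "C = max 1 (T powr b / \<delta> powr a)"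
  have C: "C \<ge> 1" "T powr b \<le> C * \<delta> powr a"
    using \<delta> by (auto simp: C_def max_def divide_simps split: if_splits)
  have "\<phi> (t * x) \<le> C * (t powr a + t powr b) * \<phi> x" if t: "t > 0" and x: "x > 0" for t x
  proof -
    have A: "t powr a \<le> C * (t powr a + t powr b)" "t powr b \<le> C * (t powr a + t powr b)"
      using C(1) mult_mono[of 1 C "t powr a" "t powr a + t powr b"]
        mult_mono[of 1 C "t powr b" "t powr a + t powr b"] by auto
    have px: "\<phi> x \<ge> 0" using pos[OF x] by simp
    consider "t < \<delta>" | "\<delta> \<le> t" "t \<le> T" | "t \<ge> T" by linarith
    then show ?thesis
    proof cases
      case 1
      show ?thesis using small[OF t 1 x] mult_right_mono[OF A(1) px] by linarith
    next
      case 3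
      show ?thesis using large[OF 3 x] mult_right_mono[OF A(2) px] by linarith
    next
      case 2
      have "\<delta> powr a \<le> t powr a" using 2 \<delta> a by (intro powr_mono2) auto
      then have "T powr b \<le> C * t powr a"
        using C by (meson mult_left_mono order_trans zero_le_one)
      also have "\<dots> \<le> C * (t powr a + t powr b)" using C(1) by simp
      finally have T: "T powr b \<le> C * (t powr a + t powr b)" .
      have "\<phi> (t * x) \<le> \<phi> (T * x)" using 2 t x by (intro le) auto
      also have "\<dots> \<le> T powr b * \<phi> x" using large x by auto
      also have "\<dots> \<le> C * (t powr a + t powr b) * \<phi> x" using T px by (rule mult_right_mono)
      finally show ?thesis .
    qed
  qed
  then show ?thesis using a(1) b(1) C(1) by (metis less_le_trans zero_less_one)
qed

text \<open>
  The infimum formulas bound the indices by single quotients.  Since \<open>\<psi>\<close> takes the value \<open>1/2\<close>, some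
  \<open>M_fun s \<phi>\<close> is below \<open>1\<close>, which makes one \<open>log_M (- u) / u\<close> negative.  The indices are ordered
  because \<open>0 = log_M 0 \<le> log_M u + log_M (- u)\<close>.
\<close>
lemma indices_of_dilation_le:
  assumes homeo: "increasing_homeo \<psi>"
    and le: "\<And>t x. t > 0 \<Longrightarrow> x > 0 \<Longrightarrow> \<phi> (t * x) \<le> \<psi> t * \<phi> x"
  shows "0 < lower_index \<phi> \<and> lower_index \<phi> \<le> upper_index \<phi> \<and> upper_index \<phi> < \<infinity>"
proof -
  have M_le: "M_fun t \<phi> \<le> ereal (\<psi> t)" if "t > 0" for t
    using that le by (simp add: M_fun_le_iff)
  then have fin: "M_fun t \<phi> < \<infinity>" if "t > 0" for t
    using le_less_trans[OF M_le[OF that], of \<infinity>] by simp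
  have up: "upper_index \<phi> = (INF u\<in>{0<..}. ereal (log_M u / u))"
    unfolding upper_index_def by (intro tendsto_Lim upper_index_tendsto_finite fin) simp
  have "upper_index \<phi> \<le> ereal (log_M 1 / 1)" unfolding up by (rule INF_lower) simp
  then have "upper_index \<phi> < \<infinity>" by (rule le_less_trans) simp
  moreover have "0 < lower_index \<phi>"
  proof -
    obtain s where s: "s \<ge> 0" "\<psi> s = 1/2"
    proof -
      have "1/2 \<in> \<psi> ` {0..}" using homeo unfolding increasing_homeo_iff by simp
      then show ?thesis using that by auto
    qed
    have "s \<noteq> 0" using s increasing_homeo_zero[OF homeo] by auto
    then have s0: "s > 0" using s by simp
    have lt: "M_fun s \<phi> < 1"
      by (rule le_less_trans[OF M_le[OF s0]]) (simp add: s one_ereal_def)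
    then have s1: "s < 1" using M_fun_mono[of 1 s] M_fun_one by fastforce
    define u where "u = - ln s"
    have u: "u > 0" using s0 s1 by (simp add: u_def)
    have "log_M (- u) < 0" using lt M_fun_exp[of "- u"] fin[OF s0] s0 by (simp add: u_def one_ereal_def)
    then have "log_M (- u) / u < 0" using u by (simp add: divide_neg_pos)
    moreover have "(INF u\<in>{0<..}. ereal (log_M (- u) / u)) \<le> ereal (log_M (- u) / u)"
      using u by (intro INF_lower) simp
    ultimately have "(INF u\<in>{0<..}. ereal (log_M (- u) / u)) < 0"
      by (metis less_ereal.simps(1) le_less_trans zero_ereal_def)
    then show ?thesis
      unfolding lower_index_eq
      using ereal_less_uminus_reorder[of 0 "INF u\<in>{0<..}. ereal (log_M (- u) / u)"]
      by (metis ereal_uminus_zero)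
  qed
  moreover have "lower_index \<phi> \<le> upper_index \<phi>"
  proof -
    have quot: "- ereal (log_M (- u) / u) \<le> ereal (log_M u / u)" if "u > 0" for u
    proof -
      have "log_M (u + - u) \<le> log_M u + log_M (- u)"
        by (intro log_M_subadditive fin) auto
      then have "- log_M (- u) \<le> log_M u" by (simp add: log_M_zero)
      then have "- log_M (- u) / u \<le> log_M u / u" using that by (intro divide_right_mono) auto
      then show ?thesis by simp
    qed
    show ?thesis unfolding lower_index_eq up
    proof (rule tendsto_le[OF trivial_limit_at_top_linorder log_M_tendsto[OF fin] tendsto_uminus_ereal[OF log_M_neg_tendsto]])
      show "\<forall>\<^sub>F u in at_top. - ereal (log_M (- u) / u) \<le> ereal (log_M u / u)"
        using eventually_gt_at_top[of 0] by eventually_elim (rule quot)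
    qed
  qed
  ultimately show ?thesis by blast
qed

end

section \<open>The equivalence\<close>

text \<open>
  Each bound at \<open>(t, x)\<close> is the other one at \<open>(inverse t, t * x)\<close>, solved for the factor.
\<close>
lemma dilation_inverse:
  fixes \<phi> \<psi> :: "real \<Rightarrow> real"
  assumes pos: "\<And>t. t > 0 \<Longrightarrow> \<psi> t > 0"
  shows "(\<forall>t>0. \<forall>x>0. \<phi> (t * x) \<le> \<psi> t * \<phi> x)
     \<longleftrightarrow> (\<forall>t>0. \<forall>x>0. inverse (\<psi> (inverse t)) * \<phi> x \<le> \<phi> (t * x))" (is "?L \<longleftrightarrow> ?R")
proof -
  have swap: "inverse c * a \<le> b \<longleftrightarrow> a \<le> c * b" if "c > 0" for a b c :: real
    using that by (simp add: field_simps)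
  show ?thesis
  proof (intro iffI allI impI)
    fix t x :: real assume L: ?L and t: "t > 0" and x: "x > 0"
    have "\<phi> (inverse t * (t * x)) \<le> \<psi> (inverse t) * \<phi> (t * x)"
      using t x by (intro L[rule_format]) auto
    moreover have "inverse t * (t * x) = x" using t by simp
    ultimately have "\<phi> x \<le> \<psi> (inverse t) * \<phi> (t * x)" by (simp only:)
    then show "inverse (\<psi> (inverse t)) * \<phi> x \<le> \<phi> (t * x)"
      using t pos[of "inverse t"] by (simp only: swap positive_imp_inverse_positive)
  next
    fix t x :: real assume R: ?R and t: "t > 0" and x: "x > 0"
    have "inverse (\<psi> (inverse (inverse t))) * \<phi> (t * x) \<le> \<phi> (inverse t * (t * x))"
      using t x by (intro R[rule_format]) auto
    moreover have "inverse t * (t * x) = x" using t by simp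
    ultimately have "inverse (\<psi> t) * \<phi> (t * x) \<le> \<phi> x" by (simp only: inverse_inverse_eq)
    then show "\<phi> (t * x) \<le> \<psi> t * \<phi> x"
      using t pos[of t] by (simp only: swap)
  qed
qed

theorem theorem4p4:
  fixes \<phi> :: "real \<Rightarrow> real"
  assumes "\<phi> \<in> {0..} \<rightarrow> {0..}"
    and "\<not> bounded (\<phi> ` {0..})"
    and "strict_mono_on {0..} \<phi>"
    and "continuous_on {0..} \<phi>"
    and "\<phi> 0 = 0"
  shows "((0 < lower_index \<phi> \<and> lower_index \<phi> \<le> upper_index \<phi> \<and> upper_index \<phi> < \<infinity>)
           \<longleftrightarrow> (\<exists>\<psi>1 \<psi>2. increasing_homeo \<psi>1 \<and> increasing_homeo \<psi>2 \<and>
                 (\<forall>t>0. \<forall>x>0. \<psi>1 t * \<phi> x \<le> \<phi> (t * x) \<and> \<phi> (t * x) \<le> \<psi>2 t * \<phi> x)))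
       \<and> ((\<exists>\<psi>1 \<psi>2. increasing_homeo \<psi>1 \<and> increasing_homeo \<psi>2 \<and>
                 (\<forall>t>0. \<forall>x>0. \<psi>1 t * \<phi> x \<le> \<phi> (t * x) \<and> \<phi> (t * x) \<le> \<psi>2 t * \<phi> x))
           \<longleftrightarrow> (\<exists>\<psi>1 \<psi>2. increasing_homeo \<psi>1 \<and> \<psi>2 \<in> {0..} \<rightarrow> {0..} \<and>
                 (\<forall>t>0. \<forall>x>0. \<psi>1 t * \<phi> x \<le> \<phi> (t * x) \<and> \<phi> (t * x) \<le> \<psi>2 t * \<phi> x)))"
proof -
  interpret increasing_half_line \<phi> using assms by unfold_locales auto
  let ?i = "0 < lower_index \<phi> \<and> lower_index \<phi> \<le> upper_index \<phi> \<and> upper_index \<phi> < \<infinity>"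
  let ?bd = "\<lambda>\<psi>1 \<psi>2. \<forall>t>0. \<forall>x>0. \<psi>1 t * \<phi> x \<le> \<phi> (t * x) \<and> \<phi> (t * x) \<le> \<psi>2 t * \<phi> x"
  let ?ii = "\<exists>\<psi>1 \<psi>2. increasing_homeo \<psi>1 \<and> increasing_homeo \<psi>2 \<and> ?bd \<psi>1 \<psi>2"
  let ?iii = "\<exists>\<psi>1 \<psi>2. increasing_homeo \<psi>1 \<and> \<psi>2 \<in> {0..} \<rightarrow> {0..} \<and> ?bd \<psi>1 \<psi>2"
  have i_ii: ?ii if ?i
  proof -
    obtain a b C where *: "a > 0" "b > 0" "C > 0"
      "\<And>t x. t > 0 \<Longrightarrow> x > 0 \<Longrightarrow> \<phi> (t * x) \<le> C * (t powr a + t powr b) * \<phi> x"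
      using dilation_le_of_indices \<open>?i\<close> by blast
    define \<psi> where "\<psi> t = C * (t powr a + t powr b)" for t
    have \<psi>: "increasing_homeo \<psi>"
      unfolding \<psi>_def using increasing_homeo_sum_powr *(1-3) by blast
    have up: "\<forall>t>0. \<forall>x>0. \<phi> (t * x) \<le> \<psi> t * \<phi> x" using *(4) by (simp add: \<psi>_def)
    then have "\<forall>t>0. \<forall>x>0. inverse (\<psi> (inverse t)) * \<phi> x \<le> \<phi> (t * x)"
      by (subst dilation_inverse[symmetric]) (auto intro: increasing_homeo_pos[OF \<psi>])
    then show ?thesis using up \<psi> increasing_homeo_inverse_conj[OF \<psi>] by blast
  qed
  have ii_i: ?i if ?ii using that indices_of_dilation_le by blast
  have ii_iii: ?iii if ?ii
  proof -
    from that obtain \<psi>1 \<psi>2 where *: "increasing_homeo \<psi>1" "increasing_homeo \<psi>2" "?bd \<psi>1 \<psi>2" by blast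
    then have "\<psi>2 \<in> {0..} \<rightarrow> {0..}" by (auto simp: increasing_homeo_iff)
    then show ?thesis using * by blast
  qed
  have iii_ii: ?ii if ?iii
  proof -
    from that obtain \<psi>1 where *: "increasing_homeo \<psi>1"
      and lo: "\<forall>t>0. \<forall>x>0. \<psi>1 t * \<phi> x \<le> \<phi> (t * x)" by blast
    define \<psi>2 where "\<psi>2 t = inverse (\<psi>1 (inverse t))" for t
    have \<psi>2: "increasing_homeo \<psi>2" unfolding \<psi>2_def using * by (rule increasing_homeo_inverse_conj)
    have "\<forall>t>0. \<forall>x>0. inverse (\<psi>2 (inverse t)) * \<phi> x \<le> \<phi> (t * x)" using lo by (simp add: \<psi>2_def)
    then have "\<forall>t>0. \<forall>x>0. \<phi> (t * x) \<le> \<psi>2 t * \<phi> x"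
      by (subst dilation_inverse) (auto intro: increasing_homeo_pos[OF \<psi>2])
    then show ?thesis using * \<psi>2 lo by blast
  qed
  show ?thesis using i_ii ii_i ii_iii iii_ii by blast
qed

end
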